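(* Given $0<p<q<\infty$, there is a $\varphi$-function $G$ such that $p_m(G)=p$, $q_m(G)=q$, $p(L_{1,G})=p/q$ and $q(L_{1,G})=q/p$.
   Context: A $\varphi$-function is a continuous, strictly increasing function $F:[0,\infty)\to[0,\infty)$ with $F(0)=0$ and $\lim_{t\to\infty}F(t)=\infty$. For a $\varphi$-function $F$ put $\tilde F(t)=1/F(1/t)$ for $t>0$ and $\tilde F(0)=0$. All functions live on $[0,\infty)$ with Lebesgue measure $\lambda$; $f^*(x)=\sup\{t:\lambda(|f|\ge t)\ge x\}$. Luxemburg functional: $\|f\|_G=\inf\{c>0:\int_0^\infty G(|f(x)|/c)\,dx\le1\}$. Orlicz--Lorentz functional: $\|f\|_{F,G}=\|f^*\circ\tilde F\circ\tilde G^{-1}\|_G$, space $L_{F,G}=\{f:\|f\|_{F,G}<\infty\}$; $L_{1,G}$ denotes $L_{T^1,G}$ where $T^1(t)=t$, so $\|f\|_{1,G}=\|f^*\circ\tilde G^{-1}\|_G$. Dilation operators $d_af(x)=f(ax)$ with $\|d_a\|_{X\to X}=\sup\{\|d_af\|_X/\|f\|_X:0<\|f\|_X<\infty\}$. Lower Boyd index $p(X)=\sup\{p:\exists c<\infty,\ \|d_a\|_{X\to X}\le c\,a^{-1/p}\ \forall a<1\}$; upper Boyd index $q(X)=\inf\{q:\exists c<\infty,\ \|d_a\|_{X\to X}\le c\,a^{-1/q}\ \forall a>1\}$. Matuszewska--Orlicz indices: $p_m(G)=\sup\{p:\exists c>0,\ G(at)\ge c\,a^pG(t)\ \forall t\ge0,\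 a>1\}$, $q_m(G)=\inf\{q:\exists c<\infty,\ G(at)\le c\,a^qG(t)\ \forall t\ge0,\ a>1\}$. *)

theory Defs
  imports "HOL-Analysis.Analysis"
begin

definition phi_function :: "(real \<Rightarrow> real) \<Rightarrow> bool" where
  "phi_function F \<longleftrightarrow> continuous_on {0..} F \<and> strict_mono_on {0..} F \<and> F 0 = 0
     \<and> (\<forall>t\<ge>0. F t \<ge> 0) \<and> filterlim F at_top at_top"

definition tildeF :: "(real \<Rightarrow> real) \<Rightarrow> real \<Rightarrow> real" where
  "tildeF F t = (if t > 0 then 1 / F (1 / t) else 0)"

definition tildeF_inv :: "(real \<Rightarrow> real) \<Rightarrow> real \<Rightarrow> real" where
  "tildeF_inv G = inv_into {0..} (tildeF G)"

definition rearr :: "(real \<Rightarrow> real) \<Rightarrow> real \<Rightarrow> ereal" where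
  "rearr f x = Sup {ereal t | t. emeasure lebesgue {y \<in> {0..}. t \<le> \<bar>f y\<bar>} \<ge> ennreal x}"

definition Gext :: "(real \<Rightarrow> real) \<Rightarrow> ereal \<Rightarrow> ennreal" where
  "Gext G y = (if y = \<infinity> then \<infinity> else ennreal (G (real_of_ereal y)))"

text \<open>Luxemburg functional (for nonnegative, possibly infinite valued functions); Inf {} = oo\<close>
definition luxemburg :: "(real \<Rightarrow> real) \<Rightarrow> (real \<Rightarrow> ereal) \<Rightarrow> ereal" where
  "luxemburg G g = Inf (ereal ` {c::real. c > 0 \<and>
      (\<integral>\<^sup>+ x\<in>{0..}. Gext G (g x / ereal c) \<partial>lebesgue) \<le> 1})"

definition OL_norm :: "(real \<Rightarrow> real) \<Rightarrow> (real \<Rightarrow> real) \<Rightarrow> (real \<Rightarrow> real) \<Rightarrow> ereal" where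
  "OL_norm F G f = luxemburg G (\<lambda>x. rearr f (tildeF F (tildeF_inv G x)))"

definition L1G_norm :: "(real \<Rightarrow> real) \<Rightarrow> (real \<Rightarrow> real) \<Rightarrow> ereal" where
  "L1G_norm G = OL_norm (\<lambda>t. t) G"

definition dil :: "real \<Rightarrow> (real \<Rightarrow> real) \<Rightarrow> real \<Rightarrow> real" where
  "dil a f = (\<lambda>x. f (a * x))"

definition dil_norm :: "((real \<Rightarrow> real) \<Rightarrow> ereal) \<Rightarrow> real \<Rightarrow> ereal" where
  "dil_norm N a = Sup {N (dil a f) / N f | f. f \<in> borel_measurable lebesgue \<and> 0 < N f \<and> N f < \<infinity>}"

definition lower_boyd :: "((real \<Rightarrow> real) \<Rightarrow> ereal) \<Rightarrow> ereal" where
  "lower_boyd N = Sup (ereal ` {p::real. p > 0 \<and> (\<exists>c::real. \<forall>a. 0 < a \<and> a < 1 \<longrightarrow>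
        dil_norm N a \<le> ereal (c * a powr (-1 / p)))})"

definition upper_boyd :: "((real \<Rightarrow> real) \<Rightarrow> ereal) \<Rightarrow> ereal" where
  "upper_boyd N = Inf (ereal ` {q::real. q > 0 \<and> (\<exists>c::real. \<forall>a. a > 1 \<longrightarrow>
        dil_norm N a \<le> ereal (c * a powr (-1 / q)))})"

definition pm :: "(real \<Rightarrow> real) \<Rightarrow> ereal" where
  "pm G = Sup (ereal ` {p::real. \<exists>c::real. c > 0 \<and> (\<forall>t a. t \<ge> 0 \<and> a > 1 \<longrightarrow>
        G (a * t) \<ge> c * a powr p * G t)})"

definition qm :: "(real \<Rightarrow> real) \<Rightarrow> ereal" where
  "qm G = Inf (ereal ` {q::real. \<exists>c::real. \<forall>t a. t \<ge> 0 \<and> a > 1 \<longrightarrow>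
        G (a * t) \<le> c * a powr q * G t})"

end

theory Submission
  imports Defs
begin

text \<open>
  If \<open>a powr p * G t \<le> G (a * t) \<le> a powr q * G t\<close> for \<open>a \<ge> 1\<close>, then a linear change of variables in
  the modular bounds the dilation norms by \<open>a powr (- q / p)\<close> for \<open>a < 1\<close> and by \<open>a powr (- p / q)\<close>
  for \<open>a > 1\<close>. Characteristic functions do not see more than \<open>1 / a\<close>, because at
  \<open>\<parallel>f\<parallel> = 1\<close> the value of \<open>f\<close> and the reciprocal of its support length lie at the same place of \<open>G\<close>.
  A step function with \<open>N\<close> widely separated steps, each contributing \<open>1 / N\<close> to the modular, has its
  values a factor of order a power of \<open>N\<close> below the reciprocals of its breakpoints. Hence dilation can
  act where \<open>G\<close> grows like \<open>t powr q\<close> while rescaling acts where \<open>G\<close> grows like \<open>t powr p\<close>, or the other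
  way round. It suffices that \<open>ln G\<close>, as a function of \<open>ln t\<close>, is piecewise linear with slopes \<open>p\<close> and
  \<open>q\<close> alternating on intervals whose lengths tend to infinity; such a function is obtained from the
  distance to the set of powers of 4.
\<close>

section \<open>Rearrangements and the norm of the Orlicz--Lorentz space\<close>

text \<open>The level 0 is admissible for every \<open>x\<close>, because the half-line has infinite
  measure.\<close>

lemma rearr_nonneg: "0 \<le> rearr f x"
proof -
  have "{y. 0 \<le> (y::real)} = {0..}" by auto
  moreover have "emeasure lborel {0::real..} = \<infinity>"
  proof (rule ccontr)
    assume "emeasure lborel {0::real..} \<noteq> \<infinity>"
    then obtain m where m: "0 \<le> m" "emeasure lborel {0::real..} = ennreal m"
      by (cases "emeasure lborel {0::real..}") auto
    have "emeasure lborel {0..m + 1} \<le> emeasure lborel {0::real..}"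
      by (intro emeasure_mono) auto
    then show False
      using m by simp
  qed
  ultimately have "emeasure lebesgue {y \<in> {0..}. 0 \<le> \<bar>f y\<bar>} = \<infinity>"
    by simp
  then show ?thesis
    unfolding rearr_def by (intro Sup_upper) (auto simp: zero_ereal_def)
qed

lemma rearr_antimono:
  assumes "x \<le> y"
  shows "rearr f y \<le> rearr f x"
  unfolding rearr_def using assms
  by (intro Sup_subset_mono) (auto intro: order_trans[OF ennreal_leI])

text \<open>The map \<open>y \<mapsto> a * y\<close> carries each superlevel set of
  \<open>dil a f\<close> onto that of \<open>f\<close>. The scaling law of Lebesgue measure holds
  for arbitrary sets, so \<open>f\<close> may be any function.\<close>

lemma rearr_dil:
  assumes a: "0 < a" and "0 \<le> x"
  shows "rearr (dil a f) x = rearr f (a * x)"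
proof -
  have "ennreal x \<le> emeasure lebesgue {y \<in> {0..}. t \<le> \<bar>dil a f y\<bar>} \<longleftrightarrow>
        ennreal (a * x) \<le> emeasure lebesgue {y \<in> {0..}. t \<le> \<bar>f y\<bar>}" for t
  proof -
    let ?A = "{y \<in> {0..}. t \<le> \<bar>dil a f y\<bar>}" and ?B = "{y \<in> {0..}. t \<le> \<bar>f y\<bar>}"
    have "(\<lambda>y. a *\<^sub>R y + 0) ` ?A = ?B"
    proof (intro equalityI subsetI)
      fix y assume "y \<in> ?B"
      then show "y \<in> (\<lambda>y. a *\<^sub>R y + 0) ` ?A"
        using a by (intro image_eqI[of _ _ "y / a"]) (auto simp: dil_def)
    qed (use a in \<open>auto simp: dil_def\<close>)
    then have "emeasure lebesgue ?B = ennreal a * emeasure lebesgue ?A"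
      using emeasure_lebesgue_affine[of a 0 ?A] a by simp
    moreover have "ennreal (a * x) = ennreal a * ennreal x"
      using assms by (simp add: ennreal_mult)
    ultimately show ?thesis
      using a by (simp add: ennreal_mult_le_mult_iff)
  qed
  then show ?thesis
    unfolding rearr_def by simp
qed

text \<open>The superlevel sets are intervals. This gives the integrand of the modular the
  measurability needed for a change of variables.\<close>

lemma borel_measurable_antimono_indicator:
  fixes h :: "real \<Rightarrow> ennreal"
  assumes "antimono_on {0..} h"
  shows "(\<lambda>x. h x * indicator {0..} x) \<in> borel_measurable borel"
proof (rule borel_measurableI_greater)
  fix y
  have "is_interval {x. y < h x * indicator {0..} x}"
    unfolding is_interval_1
  proof (intro ballI allI impI)
    fix u v w
    assume "u \<in> {x. y < h x * indicator {0..} x}" "v \<in> {x. y < h x * indicator {0..} x}"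
      and "u \<le> w \<and> w \<le> v"
    moreover from this have "0 \<le> u"
      by (cases "0 \<le> u") simp_all
    ultimately show "w \<in> {x. y < h x * indicator {0..} x}"
      using monotone_onD[OF assms, of w v] by (auto intro: less_le_trans)
  qed
  then show "{x \<in> space borel. y < h x * indicator {0..} x} \<in> sets borel"
    by (simp add: real_interval_borel_measurable)
qed

lemma nn_integral_antimono_scale:
  fixes h :: "real \<Rightarrow> ennreal"
  assumes "antimono_on {0..} h" and k: "0 < k"
  shows "ennreal k * (\<integral>\<^sup>+x\<in>{0..}. h (k * x) \<partial>lebesgue) = (\<integral>\<^sup>+x\<in>{0..}. h x \<partial>lebesgue)"
proof -
  have "(\<integral>\<^sup>+x. h x * indicator {0..} x \<partial>lborel) =
      ennreal \<bar>k\<bar> * (\<integral>\<^sup>+x. h (0 + k * x) * indicator {0..} (0 + k * x) \<partial>lborel)"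
    using nn_integral_real_affine[OF borel_measurable_antimono_indicator[OF assms(1)], of k 0] k
    by simp
  also have "(\<lambda>x. h (0 + k * x) * indicator {0..} (0 + k * x)) = (\<lambda>x. h (k * x) * indicator {0..} x)"
    using k by (auto simp: indicator_def zero_le_mult_iff)
  finally show ?thesis
    using k by (simp add: nn_integral_completion)
qed

text \<open>The integral in the Luxemburg functional for \<open>L1G_norm G\<close>. The factor
  \<open>tildeF (\<lambda>t. t)\<close> is left out, being the identity on the half-line.\<close>

definition orlicz_modular :: "(real \<Rightarrow> real) \<Rightarrow> (real \<Rightarrow> real) \<Rightarrow> real \<Rightarrow> ennreal" where
  "orlicz_modular G f c = (\<integral>\<^sup>+x\<in>{0..}. Gext G (rearr f (tildeF_inv G x) / ereal c) \<partial>lebesgue)"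

section \<open>Phi-functions and the inverse of \<open>tildeF G\<close>\<close>

context
  fixes G :: "real \<Rightarrow> real"
  assumes G: "phi_function G"
begin

lemma phi_function_zero: "G 0 = 0"
  using G by (simp add: phi_function_def)

lemma phi_function_less: "0 \<le> x \<Longrightarrow> x < y \<Longrightarrow> G x < G y"
  using G by (auto simp: phi_function_def strict_mono_on_def)

lemma phi_function_mono: "0 \<le> x \<Longrightarrow> x \<le> y \<Longrightarrow> G x \<le> G y"
  using phi_function_less[of x y] by (cases "x = y") auto

lemma phi_function_le_iff: "0 \<le> x \<Longrightarrow> 0 \<le> y \<Longrightarrow> G x \<le> G y \<longleftrightarrow> x \<le> y"
  using phi_function_less[of y x] phi_function_mono[of x y] by (cases "x \<le> y") auto

lemma phi_function_pos: "0 < x \<Longrightarrow> 0 < G x"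
  using phi_function_less[of 0 x] phi_function_zero by simp

lemma phi_function_nonneg: "0 \<le> x \<Longrightarrow> 0 \<le> G x"
  using G unfolding phi_function_def by blast

lemma phi_function_surj:
  assumes "0 \<le> z"
  shows "\<exists>t\<ge>0. G t = z"
proof -
  have "eventually (\<lambda>t. z \<le> G t \<and> 0 \<le> t) at_top"
    using G unfolding phi_function_def filterlim_at_top
    by (intro eventually_conj eventually_ge_at_top) auto
  then obtain b where b: "z \<le> G b" "0 \<le> b"
    unfolding eventually_at_top_linorder by blast
  have "continuous_on {0..} G"
    using G unfolding phi_function_def by blast
  then have "continuous_on {0..b} G"
    by (rule continuous_on_subset) auto
  then have "\<exists>t. 0 \<le> t \<and> t \<le> b \<and> G t = z"
    using b assms phi_function_zero by (intro IVT') auto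
  then show ?thesis
    by blast
qed

lemma tildeF_le_iff:
  assumes "0 \<le> x" "0 \<le> y"
  shows "tildeF G x \<le> tildeF G y \<longleftrightarrow> x \<le> y"
proof (cases "x = 0 \<or> y = 0")
  case True
  then show ?thesis
    using assms phi_function_pos[of "1/x"] phi_function_pos[of "1/y"]
    by (auto simp: tildeF_def less_imp_le not_le)
next
  case False
  then have "0 < x" "0 < y" using assms by auto
  then have "tildeF G x \<le> tildeF G y \<longleftrightarrow> G (1 / y) \<le> G (1 / x)"
    using phi_function_pos[of "1/x"] phi_function_pos[of "1/y"]
    by (simp add: tildeF_def frac_le_eq divide_le_cancel) (simp add: field_simps)
  also have "\<dots> \<longleftrightarrow> x \<le> y"
    using \<open>0 < x\<close> \<open>0 < y\<close> by (subst phi_function_le_iff) (auto simp: field_simps)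
  finally show ?thesis .
qed

lemma tildeF_surj:
  assumes "0 \<le> x"
  shows "x \<in> tildeF G ` {0..}"
proof (cases "x = 0")
  case True
  then show ?thesis by (intro image_eqI[of _ _ 0]) (auto simp: tildeF_def)
next
  case False
  with assms have x: "0 < x" by simp
  then obtain t where t: "t \<ge> 0" "G t = 1 / x"
    using phi_function_surj[of "1/x"] by auto
  have "t \<noteq> 0"
    using t x phi_function_zero by auto
  then show ?thesis
    using t by (intro image_eqI[of _ _ "1 / t"]) (auto simp: tildeF_def)
qed

lemma tildeF_tildeF_inv: "0 \<le> x \<Longrightarrow> tildeF G (tildeF_inv G x) = x"
  unfolding tildeF_inv_def by (intro f_inv_into_f tildeF_surj)

lemma tildeF_inv_nonneg: "0 \<le> x \<Longrightarrow> 0 \<le> tildeF_inv G x"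
  unfolding tildeF_inv_def using inv_into_into[OF tildeF_surj] by simp

text \<open>Since \<open>tildeF G\<close> is an increasing bijection of the half-line, a bound on
  its inverse can be checked on \<open>tildeF G\<close> itself; the inverse is later compared only
  in this form.\<close>

lemma tildeF_inv_le_iff:
  assumes "0 \<le> x" "0 \<le> y"
  shows "tildeF_inv G x \<le> y \<longleftrightarrow> x \<le> tildeF G y"
  using tildeF_le_iff[OF tildeF_inv_nonneg[OF assms(1)] assms(2)] assms
  by (simp add: tildeF_tildeF_inv)

lemma tildeF_inv_pos: "0 < x \<Longrightarrow> 0 < tildeF_inv G x"
  using tildeF_inv_le_iff[of x 0] by (auto simp: tildeF_def)

lemma tildeF_inv_mono: "0 \<le> x \<Longrightarrow> x \<le> y \<Longrightarrow> tildeF_inv G x \<le> tildeF_inv G y"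
  by (subst tildeF_inv_le_iff) (auto simp: tildeF_tildeF_inv tildeF_inv_nonneg)

lemma Gext_mono: "0 \<le> x \<Longrightarrow> x \<le> y \<Longrightarrow> Gext G x \<le> Gext G y"
  by (cases x; cases y) (auto simp: Gext_def intro!: ennreal_leI phi_function_mono)

section \<open>The norm and its modular under dilation\<close>

lemma L1G_norm_eq: "L1G_norm G f = Inf (ereal ` {c. c > 0 \<and> orlicz_modular G f c \<le> 1})"
proof -
  have "tildeF (\<lambda>t. t) x = x" if "0 \<le> x" for x
    using that by (auto simp: tildeF_def)
  then have "(\<integral>\<^sup>+x\<in>{0..}. Gext G (rearr f (tildeF (\<lambda>t. t) (tildeF_inv G x)) / ereal c) \<partial>lebesgue) = orlicz_modular G f c" for c
    unfolding orlicz_modular_def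
    by (intro nn_integral_cong) (auto simp: indicator_def tildeF_inv_nonneg)
  then show ?thesis
    by (simp add: L1G_norm_def OL_norm_def luxemburg_def)
qed

lemma modular_antimono:
  assumes "0 < c" "c \<le> d"
  shows "orlicz_modular G f d \<le> orlicz_modular G f c"
proof -
  have "r / ereal d \<le> r / ereal c" if "0 \<le> r" for r
  proof (cases r)
    case (real s)
    then have "s / d \<le> s / c"
      using that assms by (intro divide_left_mono) auto
    then show ?thesis using real assms by simp
  qed (use that assms in auto)
  moreover have "0 \<le> r / ereal d" if "0 \<le> r" for r
    using that assms by simp
  ultimately show ?thesis
    unfolding orlicz_modular_def
    by (intro nn_integral_mono mult_right_mono Gext_mono) (simp_all add: rearr_nonneg)
qed

lemma L1G_norm_leI: "0 < c \<Longrightarrow> orlicz_modular G f c \<le> 1 \<Longrightarrow> L1G_norm G f \<le> ereal c"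
  unfolding L1G_norm_eq by (intro Inf_lower) auto

lemma L1G_norm_geI:
  assumes "1 < orlicz_modular G f c"
  shows "ereal c \<le> L1G_norm G f"
  unfolding L1G_norm_eq
proof (intro Inf_greatest; clarsimp)
  fix d assume "0 < d" "orlicz_modular G f d \<le> 1"
  then show "c \<le> d"
    using modular_antimono[of d c f] assms by (cases "c \<le> d") auto
qed

text \<open>Comparing \<open>a * tildeF_inv G x\<close> with \<open>tildeF_inv G (k * x)\<close> turns the dilation of \<open>f\<close> into a
  linear change of variables in the integral.\<close>

lemma modular_dil_le:
  assumes "0 < a" "0 < l" "0 < k" "0 < c"
    and tl: "\<And>z. 0 < z \<Longrightarrow> k * tildeF G z \<le> tildeF G (a * z)"
    and Gl: "\<And>u. 0 < u \<Longrightarrow> G (u / l) \<le> k * G u"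
  shows "orlicz_modular G (dil a f) (l * c) \<le> orlicz_modular G f c"
proof -
  define h where "h x = Gext G (rearr f (tildeF_inv G x) / ereal c)" for x
  have anti: "antimono_on {0..} h"
    using \<open>0 < c\<close> unfolding h_def
    by (intro monotone_onI Gext_mono ereal_divide_right_mono rearr_antimono tildeF_inv_mono)
      (auto simp: rearr_nonneg)
  \<comment> \<open>This is \<open>Gl\<close> extended to the value 0, where \<open>G\<close>
    vanishes, and to infinity, where both sides are infinite.\<close>
  have G_scale: "Gext G (r / ereal (l * c)) \<le> ennreal k * Gext G (r / ereal c)" if "0 \<le> r" for r
  proof (cases r)
    case (real s)
    have "G ((s / c) / l) \<le> k * G (s / c)"
    proof (cases "s = 0")
      case False
      then show ?thesis using Gl[of "s / c"] real that \<open>0 < c\<close> by auto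
    qed (simp add: phi_function_zero)
    then show ?thesis
      using real that assms
      by (auto simp: Gext_def ennreal_mult[symmetric] phi_function_nonneg mult.commute intro!: ennreal_leI)
  next
    case PInf
    then show ?thesis using assms by (auto simp: Gext_def ennreal_mult_eq_top_iff ennreal_mult_top)
  qed (use that in auto)
  \<comment> \<open>For \<open>0 < x\<close> this is \<open>tl\<close> at
    \<open>z = tildeF_inv G x\<close>, where \<open>tildeF G z = x\<close>. For \<open>x = 0\<close>
    the default \<open>tildeF G 0 = 0\<close> makes both sides 0.\<close>
  have arg: "tildeF_inv G (k * x) \<le> a * tildeF_inv G x" if "0 \<le> x" for x
  proof (cases "x = 0")
    case True
    then show ?thesis
      using tildeF_inv_le_iff[of 0 0] tildeF_inv_nonneg[of 0] by (auto simp: tildeF_def)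
  next
    case False
    with that have "0 < x" by simp
    then have "k * x \<le> tildeF G (a * tildeF_inv G x)"
      using tl[OF tildeF_inv_pos] that by (simp add: tildeF_tildeF_inv)
    then show ?thesis
      using that assms by (subst tildeF_inv_le_iff) (auto simp: tildeF_inv_nonneg)
  qed
  have "orlicz_modular G (dil a f) (l * c) \<le> (\<integral>\<^sup>+x\<in>{0..}. ennreal k * h (k * x) \<partial>lebesgue)"
    unfolding orlicz_modular_def
  proof (intro nn_integral_mono)
    fix x :: real
    show "Gext G (rearr (dil a f) (tildeF_inv G x) / ereal (l * c)) * indicator {0..} x
        \<le> ennreal k * h (k * x) * indicator {0..} x"
    proof (cases "0 \<le> x")
      case True
      have "Gext G (rearr (dil a f) (tildeF_inv G x) / ereal (l * c))
          \<le> ennreal k * Gext G (rearr (dil a f) (tildeF_inv G x) / ereal c)"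
        by (intro G_scale rearr_nonneg)
      also have "\<dots> \<le> ennreal k * h (k * x)"
        unfolding h_def using True assms(1,4)
        by (intro mult_left_mono Gext_mono ereal_divide_right_mono)
          (auto simp: rearr_dil tildeF_inv_nonneg rearr_nonneg intro!: rearr_antimono arg)
      finally show ?thesis using True by simp
    qed simp
  qed
  also have "\<dots> = ennreal k * (\<integral>\<^sup>+x\<in>{0..}. h (k * x) \<partial>lebesgue)"
  proof -
    have "antimono_on {0..} (\<lambda>x. h (k * x))"
      using monotone_onD[OF anti] \<open>0 < k\<close> by (intro monotone_onI) auto
    then have "(\<lambda>x. h (k * x) * indicator {0..} x) \<in> borel_measurable lebesgue"
      using borel_measurable_antimono_indicator by (intro measurable_completion) auto
    then show ?thesis
      by (simp add: mult.assoc nn_integral_cmult)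
  qed
  also have "\<dots> = orlicz_modular G f c"
    using nn_integral_antimono_scale[OF anti \<open>0 < k\<close>] by (simp add: orlicz_modular_def h_def)
  finally show ?thesis .
qed

lemma L1G_norm_nonneg: "0 \<le> L1G_norm G f"
  unfolding L1G_norm_eq by (intro Inf_greatest) auto

lemma L1G_norm_dil_le:
  assumes "0 < a" "0 < l" "0 < k"
    and "\<And>z. 0 < z \<Longrightarrow> k * tildeF G z \<le> tildeF G (a * z)"
    and "\<And>u. 0 < u \<Longrightarrow> G (u / l) \<le> k * G u"
  shows "L1G_norm G (dil a f) \<le> ereal l * L1G_norm G f"
proof -
  \<comment> \<open>With \<open>l\<close> on the left, the right side is a plain infimum: each
    \<open>c\<close> admissible for \<open>f\<close> makes \<open>l * c\<close> admissible for the
    dilation.\<close>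
  have "L1G_norm G (dil a f) / ereal l \<le> L1G_norm G f"
    unfolding L1G_norm_eq[of f]
  proof (intro Inf_greatest, clarify)
    fix c assume c: "0 < c" "orlicz_modular G f c \<le> 1"
    have "L1G_norm G (dil a f) \<le> ereal (l * c)"
      using modular_dil_le[OF assms(1-3) c(1) assms(4,5), of f] c assms(2)
      by (intro L1G_norm_leI) (auto intro: order_trans)
    then show "L1G_norm G (dil a f) / ereal l \<le> ereal c"
      using assms(2) by (subst ereal_divide_le_pos) auto
  qed
  then show ?thesis
    using assms(2) by (subst (asm) ereal_divide_le_pos) simp_all
qed

end

section \<open>Step functions\<close>

lemma nn_integral_sum_indicator:
  fixes b :: "'i \<Rightarrow> ennreal"
  assumes "\<And>i. i \<in> I \<Longrightarrow> A i \<in> sets M"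
  shows "(\<integral>\<^sup>+x. (\<Sum>i\<in>I. b i * indicator (A i) x) \<partial>M) = (\<Sum>i\<in>I. b i * emeasure M (A i))"
proof -
  have "(\<integral>\<^sup>+x. (\<Sum>i\<in>I. b i * indicator (A i) x) \<partial>M) = (\<Sum>i\<in>I. \<integral>\<^sup>+x. b i * indicator (A i) x \<partial>M)"
    using assms by (intro nn_integral_sum borel_measurable_times_ennreal borel_measurable_indicator) auto
  then show ?thesis
    using assms by (simp add: nn_integral_cmult_indicator)
qed

text \<open>As a maximum, the step function is decreasing whatever the order of the steps, and
  \<open>T\<close> need not be enumerated.\<close>

definition step_fun :: "real set \<Rightarrow> (real \<Rightarrow> real) \<Rightarrow> (real \<Rightarrow> real) \<Rightarrow> real \<Rightarrow> real" where
  "step_fun T lam y x = Max ((\<lambda>s. if x \<le> y s then lam s else 0) ` T)"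

context
  fixes T :: "real set" and lam y :: "real \<Rightarrow> real"
  assumes T: "finite T" "T \<noteq> {}" and lam: "\<And>s. s \<in> T \<Longrightarrow> 0 < lam s"
    and y: "\<And>s. s \<in> T \<Longrightarrow> 0 < y s"
begin

lemma step_fun_cases:
  obtains s where "s \<in> T" "step_fun T lam y x = (if x \<le> y s then lam s else 0)"
proof -
  have "step_fun T lam y x \<in> (\<lambda>s. if x \<le> y s then lam s else 0) ` T"
    unfolding step_fun_def using T by (intro Max_in) auto
  then show ?thesis using that by blast
qed

lemma step_fun_ge: "s \<in> T \<Longrightarrow> x \<le> y s \<Longrightarrow> lam s \<le> step_fun T lam y x"
  unfolding step_fun_def using T by (intro Max_ge) (auto intro!: image_eqI[of _ _ s])

lemma step_fun_nonneg: "0 \<le> step_fun T lam y x"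
proof -
  obtain s where "s \<in> T" "step_fun T lam y x = (if x \<le> y s then lam s else 0)"
    by (rule step_fun_cases)
  then show ?thesis using lam[of s] by simp
qed

lemma step_fun_measurable: "step_fun T lam y \<in> borel_measurable borel"
  unfolding step_fun_def[abs_def] using T by measurable

lemma rearr_step_fun_ge:
  assumes "s \<in> T" "x \<le> y s"
  shows "ereal (lam s) \<le> rearr (step_fun T lam y) x"
proof -
  have "ennreal x \<le> ennreal (y s)"
    using assms by (intro ennreal_leI)
  also have "\<dots> = emeasure lebesgue {0..y s}"
    using y[OF assms(1)] by simp
  also have "\<dots> \<le> emeasure lebesgue {x \<in> {0..}. lam s \<le> \<bar>step_fun T lam y x\<bar>}"
  proof (rule emeasure_mono)
    show "{0..y s} \<subseteq> {x \<in> {0..}. lam s \<le> \<bar>step_fun T lam y x\<bar>}"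
      using step_fun_ge[OF assms(1)] by (auto intro: order_trans[OF _ abs_ge_self])
    have [measurable]: "step_fun T lam y \<in> borel_measurable borel"
      by (rule step_fun_measurable)
    have "{x \<in> space borel. 0 \<le> x \<and> lam s \<le> \<bar>step_fun T lam y x\<bar>} \<in> sets borel"
      by measurable
    then show "{x \<in> {0..}. lam s \<le> \<bar>step_fun T lam y x\<bar>} \<in> sets lebesgue"
      by simp
  qed
  finally show ?thesis
    unfolding rearr_def by (intro Sup_upper) auto
qed

text \<open>The function decreases, so a level above its value at \<open>x\<close> is exceeded only
  up to a breakpoint left of \<open>x\<close>. At \<open>x = 0\<close> every level is admissible and
  the rearrangement is infinite.\<close>

lemma rearr_step_fun_le:
  assumes "0 < x"
  shows "rearr (step_fun T lam y) x \<le> ereal (step_fun T lam y x)"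
  unfolding rearr_def
proof (intro Sup_least, clarify)
  fix t assume t: "ennreal x \<le> emeasure lebesgue {z \<in> {0..}. t \<le> \<bar>step_fun T lam y z\<bar>}"
  \<comment> \<open>The last breakpoint before \<open>x\<close>, or 0 if there is none.\<close>
  define M where "M = Max (insert 0 (y ` {s \<in> T. y s < x}))"
  have M: "0 \<le> M" "M < x"
    unfolding M_def using T assms by auto
  have "t \<le> step_fun T lam y x"
  proof (rule ccontr)
    assume neg: "\<not> t \<le> step_fun T lam y x"
    have "{z \<in> {0..}. t \<le> \<bar>step_fun T lam y z\<bar>} \<subseteq> {0..M}"
    proof (clarsimp simp: step_fun_nonneg)
      fix z :: real assume z: "0 \<le> z" "t \<le> step_fun T lam y z"
      obtain s where s: "s \<in> T" "step_fun T lam y z = (if z \<le> y s then lam s else 0)"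
        by (rule step_fun_cases)
      have zs: "z \<le> y s" "t \<le> lam s"
        using s z neg step_fun_nonneg[of x] by (auto split: if_splits)
      have "y s < x"
        using step_fun_ge[of s x] s zs neg by force
      then have "y s \<le> M"
        unfolding M_def using T s by (intro Max_ge) auto
      with zs show "z \<le> M" by simp
    qed
    then have "emeasure lebesgue {z \<in> {0..}. t \<le> \<bar>step_fun T lam y z\<bar>} \<le> emeasure lebesgue {0..M}"
      by (intro emeasure_mono) auto
    with t have "ennreal x \<le> emeasure lebesgue {0..M}" by (rule order_trans)
    then show False using M by simp
  qed
  then show "ereal t \<le> ereal (step_fun T lam y x)" by simp
qed

text \<open>At each point \<open>G\<close> of the maximum is one of the terms, hence at most their
  sum. Step \<open>s\<close> lives on \<open>{0..tildeF G (y s)}\<close> after composition with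
  \<open>tildeF_inv G\<close>.\<close>

lemma modular_step_fun_le:
  assumes G: "phi_function G"
  shows "orlicz_modular G (step_fun T lam y) 1 \<le> ennreal (\<Sum>s\<in>T. G (lam s) * tildeF G (y s))"
proof -
  have ty: "0 < tildeF G (y s)" if "s \<in> T" for s
    using phi_function_pos[OF G, of "1 / y s"] y[OF that] by (simp add: tildeF_def)
  have Gl: "0 \<le> G (lam s)" if "s \<in> T" for s
    using lam[OF that] by (simp add: phi_function_nonneg[OF G])
  have pw: "Gext G (rearr (step_fun T lam y) (tildeF_inv G x) / ereal 1)
      \<le> (\<Sum>s\<in>T. ennreal (G (lam s)) * indicator {0..tildeF G (y s)} x)" if x: "0 < x" for x
  proof -
    let ?z = "tildeF_inv G x"
    have z: "0 < ?z" using x by (rule tildeF_inv_pos[OF G])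
    obtain s where s: "s \<in> T" "step_fun T lam y ?z = (if ?z \<le> y s then lam s else 0)"
      by (rule step_fun_cases)
    have "Gext G (rearr (step_fun T lam y) ?z / ereal 1) \<le> Gext G (ereal (step_fun T lam y ?z))"
      using rearr_step_fun_le[OF z] by (intro Gext_mono[OF G]) (auto simp: rearr_nonneg one_ereal_def[symmetric])
    also have "\<dots> \<le> ennreal (G (lam s)) * indicator {0..tildeF G (y s)} x"
      using s x y[OF s(1)] tildeF_inv_le_iff[OF G, of x "y s"]
      by (auto simp: Gext_def phi_function_zero[OF G])
    also have "\<dots> \<le> (\<Sum>s\<in>T. ennreal (G (lam s)) * indicator {0..tildeF G (y s)} x)"
      using s T by (intro member_le_sum) auto
    finally show ?thesis .
  qed
  have "orlicz_modular G (step_fun T lam y) 1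
      \<le> (\<integral>\<^sup>+x. (\<Sum>s\<in>T. ennreal (G (lam s)) * indicator {0..tildeF G (y s)} x) \<partial>lebesgue)"
    unfolding orlicz_modular_def
  proof (rule nn_integral_mono_AE)
    \<comment> \<open>The point 0 is removed because the rearrangement is infinite there.\<close>
    have "AE x in lebesgue. x \<noteq> (0::real)"
      using AE_lborel_singleton[of "0::real"] by (rule AE_completion)
    then show "AE x in lebesgue. Gext G (rearr (step_fun T lam y) (tildeF_inv G x) / ereal 1) * indicator {0..} x
        \<le> (\<Sum>s\<in>T. ennreal (G (lam s)) * indicator {0..tildeF G (y s)} x)"
    proof eventually_elim
      case (elim x)
      then show ?case using pw[of x] by (cases "0 < x") auto
    qed
  qed
  also have "\<dots> = (\<Sum>s\<in>T. ennreal (G (lam s)) * ennreal (tildeF G (y s)))"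
    using ty by (subst nn_integral_sum_indicator) (auto simp: less_imp_le)
  also have "\<dots> = ennreal (\<Sum>s\<in>T. G (lam s) * tildeF G (y s))"
    using ty Gl by (subst sum_ennreal[symmetric]) (auto simp: ennreal_mult less_imp_le)
  finally show ?thesis .
qed

text \<open>Only the upper halves of the intervals of constancy are counted, so that no differences of
  consecutive breakpoints appear.\<close>

lemma modular_dil_step_fun_ge:
  assumes G: "phi_function G" and a: "0 < a" and c: "0 < c"
    and sep: "\<And>s t. s \<in> T \<Longrightarrow> t \<in> T \<Longrightarrow> s < t \<Longrightarrow> 2 * tildeF G (y t / a) \<le> tildeF G (y s / a)"
  shows "ennreal (\<Sum>s\<in>T. G (lam s / c) * (tildeF G (y s / a) / 2))
    \<le> orlicz_modular G (dil a (step_fun T lam y)) c"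
proof -
  define X where "X s = tildeF G (y s / a)" for s
  have X: "0 < X s" if "s \<in> T" for s
    using phi_function_pos[OF G, of "1 / (y s / a)"] y[OF that] a by (simp add: tildeF_def X_def)
  have Gl: "0 \<le> G (lam s / c)" if "s \<in> T" for s
    using lam[OF that] c by (simp add: phi_function_nonneg[OF G])
  have pw: "(\<Sum>s\<in>T. ennreal (G (lam s / c)) * indicator {X s / 2<..X s} x)
      \<le> Gext G (rearr (dil a (step_fun T lam y)) (tildeF_inv G x) / ereal c) * indicator {0..} x" for x
  proof (cases "\<exists>s\<in>T. x \<in> {X s / 2<..X s}")
    case False
    then have "(\<Sum>s\<in>T. ennreal (G (lam s / c)) * indicator {X s / 2<..X s} x) = 0"
      by (intro sum.neutral) (auto simp: indicator_def)
    then show ?thesis by simp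
  next
    case True
    then obtain s where s: "s \<in> T" and xs: "X s / 2 < x" "x \<le> X s" by auto
    have x: "0 < x" using X[OF s] xs by simp
    \<comment> \<open>By \<open>sep\<close> the breakpoints \<open>X\<close> at least halve from one
      step to the next, so their upper halves are disjoint.\<close>
    have "x \<notin> {X t / 2<..X t}" if "t \<in> T" "t \<noteq> s" for t
      using sep[of s t] sep[of t s] that s xs unfolding X_def[symmetric] by (cases "s < t") auto
    then have "(\<Sum>t\<in>T. ennreal (G (lam t / c)) * indicator {X t / 2<..X t} x)
        = (\<Sum>t\<in>{s}. ennreal (G (lam t / c)) * indicator {X t / 2<..X t} x)"
      using T s by (intro sum.mono_neutral_right) (auto simp: indicator_def)
    also have "\<dots> = Gext G (ereal (lam s) / ereal c)"
      using xs c by (simp add: Gext_def)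
    also have "\<dots> \<le> Gext G (rearr (dil a (step_fun T lam y)) (tildeF_inv G x) / ereal c)"
    proof (intro Gext_mono[OF G] ereal_divide_right_mono)
      have "tildeF_inv G x \<le> y s / a"
        using xs x y[OF s] a by (subst tildeF_inv_le_iff[OF G]) (auto simp: X_def)
      then have "a * tildeF_inv G x \<le> y s"
        using a by (simp add: field_simps)
      then show "ereal (lam s) \<le> rearr (dil a (step_fun T lam y)) (tildeF_inv G x)"
        using rearr_step_fun_ge[OF s] x a tildeF_inv_nonneg[OF G, of x] by (simp add: rearr_dil)
    qed (use lam[OF s] c in auto)
    finally show ?thesis using x by simp
  qed
  have "ennreal (\<Sum>s\<in>T. G (lam s / c) * (X s / 2)) = (\<Sum>s\<in>T. ennreal (G (lam s / c)) * ennreal (X s / 2))"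
    using X Gl by (subst sum_ennreal[symmetric])
      (auto simp: ennreal_mult less_imp_le simp del: times_divide_eq_right)
  also have "\<dots> = (\<integral>\<^sup>+x. (\<Sum>s\<in>T. ennreal (G (lam s / c)) * indicator {X s / 2<..X s} x) \<partial>lebesgue)"
  proof -
    have "emeasure lebesgue {X s / 2<..X s} = ennreal (X s / 2)" if "s \<in> T" for s
      using X[OF that] by simp
    then show ?thesis
      by (subst nn_integral_sum_indicator) auto
  qed
  also have "\<dots> \<le> orlicz_modular G (dil a (step_fun T lam y)) c"
    unfolding orlicz_modular_def by (intro nn_integral_mono pw)
  finally show ?thesis by (simp add: X_def)
qed

text \<open>The step function is a test function of norm at most 1 by \<open>upper\<close>, and its
  dilation has norm at least \<open>c\<close> by \<open>lower\<close>; the bound 2 there pays for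
  counting only the upper halves.\<close>

lemma dil_norm_geI:
  assumes G: "phi_function G" and a: "0 < a" and c: "0 < c"
    and bounded: "\<And>f. L1G_norm G (dil a f) \<le> ereal l * L1G_norm G f"
    and sep: "\<And>s t. s \<in> T \<Longrightarrow> t \<in> T \<Longrightarrow> s < t \<Longrightarrow> 2 * tildeF G (y t / a) \<le> tildeF G (y s / a)"
    and upper: "(\<Sum>s\<in>T. G (lam s) * tildeF G (y s)) \<le> 1"
    and lower: "2 < (\<Sum>s\<in>T. G (lam s / c) * tildeF G (y s / a))"
  shows "ereal c \<le> dil_norm (L1G_norm G) a"
proof -
  define f where "f = step_fun T lam y"
  have "orlicz_modular G f 1 \<le> 1"
    using order_trans[OF modular_step_fun_le[OF G] ennreal_leI[OF upper]] by (simp add: f_def)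
  then have f1: "L1G_norm G f \<le> 1"
    using L1G_norm_leI[OF G, of 1 f] by (simp add: one_ereal_def)
  have "1 < ennreal (\<Sum>s\<in>T. G (lam s / c) * (tildeF G (y s / a) / 2))"
    using lower by (simp add: sum_divide_distrib[symmetric] ennreal_less_iff flip: ennreal_1)
  also have "\<dots> \<le> orlicz_modular G (dil a f) c"
    unfolding f_def by (rule modular_dil_step_fun_ge[OF G a c sep])
  finally have df: "ereal c \<le> L1G_norm G (dil a f)"
    by (rule L1G_norm_geI[OF G])
  \<comment> \<open>The supremum in \<open>dil_norm\<close> admits only positive norms. By
    \<open>bounded\<close>, norm 0 would pass to the dilation, against \<open>df\<close>.\<close>
  have "L1G_norm G f \<noteq> 0"
    using order_trans[OF df bounded[of f]] c by (auto simp: zero_ereal_def)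
  then have f0: "0 < L1G_norm G f"
    using L1G_norm_nonneg[OF G, of f] by simp
  have "L1G_norm G f * ereal c \<le> 1 * ereal c"
    using f1 c by (intro ereal_mult_right_mono) auto
  then have "ereal c \<le> L1G_norm G (dil a f) / L1G_norm G f"
    using order_trans[OF _ df] f0 f1 by (subst ereal_le_divide_pos) auto
  also have "\<dots> \<le> dil_norm (L1G_norm G) a"
    unfolding dil_norm_def using f0 f1 measurable_completion[of "step_fun T lam y" lborel borel]
      step_fun_measurable
    by (intro Sup_upper) (auto simp: f_def)
  finally show ?thesis .
qed

end

section \<open>Bounds on the indices\<close>

locale power_type =
  fixes G :: "real \<Rightarrow> real" and p q :: real
  assumes G: "phi_function G" and p: "0 < p" and q: "0 < q"
    and lower_type: "\<And>t a. 0 < t \<Longrightarrow> 1 \<le> a \<Longrightarrow> a powr p * G t \<le> G (a * t)"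
    and upper_type: "\<And>t a. 0 < t \<Longrightarrow> 1 \<le> a \<Longrightarrow> G (a * t) \<le> a powr q * G t"
begin

lemma G_pos: "0 < t \<Longrightarrow> 0 < G t"
  by (rule phi_function_pos[OF G])

lemma pm_ge: "ereal p \<le> pm G"
proof -
  have "\<exists>c::real. c > 0 \<and> (\<forall>t a. t \<ge> 0 \<and> a > 1 \<longrightarrow> G (a * t) \<ge> c * a powr p * G t)"
  proof (intro exI[of _ 1] conjI allI impI)
    fix t a :: real assume "0 \<le> t \<and> 1 < a"
    then show "1 * a powr p * G t \<le> G (a * t)"
      using lower_type[of t a] by (cases "t = 0") (auto simp: phi_function_zero[OF G])
  qed simp
  then show ?thesis
    unfolding pm_def by (intro Sup_upper) auto
qed

lemma qm_le: "qm G \<le> ereal q"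
proof -
  have "\<exists>c::real. \<forall>t a. t \<ge> 0 \<and> a > 1 \<longrightarrow> G (a * t) \<le> c * a powr q * G t"
  proof (intro exI[of _ 1] allI impI)
    fix t a :: real assume "0 \<le> t \<and> 1 < a"
    then show "G (a * t) \<le> 1 * a powr q * G t"
      using upper_type[of t a] by (cases "t = 0") (auto simp: phi_function_zero[OF G])
  qed
  then show ?thesis
    unfolding qm_def by (intro Inf_lower) auto
qed

text \<open>The upper type, applied with factor \<open>1 / a\<close>, gives
  \<open>k = a powr q\<close> for the dilation. The lower type then absorbs \<open>k\<close> once
  \<open>l powr p = 1 / k\<close>, which fixes \<open>l = a powr (- q / p)\<close>.\<close>

lemma L1G_norm_dil_contract:
  assumes a: "0 < a" "a < 1"
  shows "L1G_norm G (dil a f) \<le> ereal (a powr (- q / p)) * L1G_norm G f"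
proof (rule L1G_norm_dil_le[OF G, where k = "a powr q"])
  fix z :: real assume z: "0 < z"
  have "G (1 / (a * z)) \<le> (1 / a) powr q * G (1 / z)"
    using upper_type[of "1 / z" "1 / a"] a z by simp
  also have "\<dots> = G (1 / z) / a powr q"
    using a by (simp add: powr_divide)
  finally have "a powr q * G (1 / (a * z)) \<le> G (1 / z)"
    using a by (simp add: field_simps)
  then show "a powr q * tildeF G z \<le> tildeF G (a * z)"
    using z a G_pos[of "1 / z"] G_pos[of "1 / (a * z)"]
    by (simp add: tildeF_def divide_simps mult.commute)
next
  fix u :: real assume u: "0 < u"
  define l where "l = a powr (- q / p)"
  have l: "1 \<le> l"
    unfolding l_def using a p q powr_mono'[of "-q/p" 0 a] by simp
  have "l powr p = a powr (- q)"
    unfolding l_def using p by (simp add: powr_powr)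
  then have "l powr p = 1 / a powr q"
    by (simp add: powr_minus_divide)
  moreover have "l powr p * G (u / l) \<le> G u"
    using lower_type[of "u / l" l] u l by simp
  ultimately have "G (u / l) / a powr q \<le> G u"
    by simp
  then have "G (u / l) \<le> a powr q * G u"
    using a by (simp add: divide_le_eq mult.commute)
  then show "G (u / a powr (- q / p)) \<le> a powr q * G u"
    by (simp only: l_def)
qed (use a in auto)

text \<open>The types exchange roles: the lower one gives \<open>k = a powr p\<close>, and the upper
  one, applied with factor \<open>1 / l\<close>, asks for \<open>(1 / l) powr q = k\<close>.\<close>

lemma L1G_norm_dil_expand:
  assumes a: "1 < a"
  shows "L1G_norm G (dil a f) \<le> ereal (a powr (- p / q)) * L1G_norm G f"
proof (rule L1G_norm_dil_le[OF G, where k = "a powr p"])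
  fix z :: real assume z: "0 < z"
  have "a powr p * G (1 / (a * z)) \<le> G (1 / z)"
    using lower_type[of "1 / (a * z)" a] a z by simp
  then show "a powr p * tildeF G z \<le> tildeF G (a * z)"
    using z a G_pos[of "1 / z"] G_pos[of "1 / (a * z)"]
    by (simp add: tildeF_def divide_simps mult.commute)
next
  fix u :: real assume u: "0 < u"
  have "1 / a powr (- p / q) = a powr (p / q)"
    by (simp add: powr_minus_divide)
  then have "G (u / a powr (- p / q)) = G (a powr (p / q) * u)"
    by (metis mult.commute mult_1 times_divide_eq_left)
  also have "\<dots> \<le> (a powr (p / q)) powr q * G u"
    using u a p q by (intro upper_type) (auto intro: ge_one_powr_ge_zero)
  also have "(a powr (p / q)) powr q = a powr p"
    using q by (simp add: powr_powr)
  finally show "G (u / a powr (- p / q)) \<le> a powr p * G u" .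
qed (use a in auto)

lemma dil_norm_leI:
  assumes "\<And>f. L1G_norm G (dil a f) \<le> ereal l * L1G_norm G f"
  shows "dil_norm (L1G_norm G) a \<le> ereal l"
  unfolding dil_norm_def
proof (intro Sup_least, clarify)
  fix f assume "0 < L1G_norm G f" "L1G_norm G f < \<infinity>"
  then show "L1G_norm G (dil a f) / L1G_norm G f \<le> ereal l"
    using assms[of f] by (subst ereal_divide_le_pos) (auto simp: mult.commute)
qed

lemma lower_boyd_ge: "ereal (p / q) \<le> lower_boyd (L1G_norm G)"
proof -
  have bound: "\<forall>a. 0 < a \<and> a < 1 \<longrightarrow> dil_norm (L1G_norm G) a \<le> ereal (1 * a powr (- 1 / (p / q)))"
    using L1G_norm_dil_contract by (auto intro!: dil_norm_leI)
  have "p / q \<in> {P. 0 < P \<and> (\<exists>c. \<forall>a. 0 < a \<and> a < 1 \<longrightarrow>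
      dil_norm (L1G_norm G) a \<le> ereal (c * a powr (- 1 / P)))}"
    by (rule CollectI, rule conjI[OF _ exI[of _ 1]]) (use p q in simp, rule bound)
  then show ?thesis
    unfolding lower_boyd_def by (intro Sup_upper imageI)
qed

lemma upper_boyd_le: "upper_boyd (L1G_norm G) \<le> ereal (q / p)"
proof -
  have bound: "\<forall>a. 1 < a \<longrightarrow> dil_norm (L1G_norm G) a \<le> ereal (1 * a powr (- 1 / (q / p)))"
    using L1G_norm_dil_expand by (auto intro!: dil_norm_leI)
  have "q / p \<in> {Q. 0 < Q \<and> (\<exists>c. \<forall>a. 1 < a \<longrightarrow>
      dil_norm (L1G_norm G) a \<le> ereal (c * a powr (- 1 / Q)))}"
    by (rule CollectI, rule conjI[OF _ exI[of _ 1]]) (use p q in simp, rule bound)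
  then show ?thesis
    unfolding upper_boyd_def by (intro Inf_lower imageI)
qed

end

text \<open>Reads off exponents from the estimates at integers below, whose constants do not matter.
  The threshold 4 is the one from which \<open>ln (n / 4)\<close> is nonnegative.\<close>

lemma powr_growth_le:
  fixes k c \<alpha> \<beta> :: real
  assumes k: "0 < k" and le: "\<And>n::nat. 4 \<le> n \<Longrightarrow> k * real n powr \<alpha> \<le> c * real n powr \<beta>"
  shows "\<alpha> \<le> \<beta>"
proof (rule ccontr)
  assume "\<not> \<alpha> \<le> \<beta>"
  then have "filterlim (\<lambda>x. x powr (\<alpha> - \<beta>)) at_top (at_top :: real filter)"
    by (intro real_powr_at_top) simp
  then have "filterlim (\<lambda>n::nat. real n powr (\<alpha> - \<beta>)) at_top sequentially"
    by (rule filterlim_compose[OF _ filterlim_real_sequentially])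
  then have "eventually (\<lambda>n::nat. c / k < real n powr (\<alpha> - \<beta>) \<and> 4 \<le> n) sequentially"
    by (intro eventually_conj eventually_ge_at_top) (auto simp: filterlim_at_top_dense)
  then obtain n :: nat where n: "c / k < real n powr (\<alpha> - \<beta>)" "4 \<le> n"
    unfolding eventually_at_top_linorder by blast
  have "c < k * real n powr (\<alpha> - \<beta>)"
    using n k by (simp add: field_simps)
  then have "c * real n powr \<beta> < k * real n powr (\<alpha> - \<beta>) * real n powr \<beta>"
    using n by (intro mult_strict_right_mono) auto
  also have "\<dots> = k * real n powr \<alpha>"
    by (simp add: powr_add[symmetric] mult.assoc)
  finally show False
    using le[OF n(2)] by simp
qed

section \<open>The distance to the powers of 4\<close>

definition kinks :: "real set" where
  "kinks = range (\<lambda>k::nat. 4 ^ k)"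

text \<open>All other powers of 4 are at least \<open>3 / 4 * 4 ^ k\<close> away from
  \<open>4 ^ k\<close>, so \<open>4 ^ k\<close> remains nearest within the given radius.\<close>

lemma infdist_kinks:
  "infdist x kinks = \<bar>x - 4 ^ k\<bar>" if "\<bar>x - 4 ^ k\<bar> \<le> 4 ^ k / 4" for k :: nat
proof (rule antisym)
  show "infdist x kinks \<le> \<bar>x - 4 ^ k\<bar>"
    using infdist_le[of "4 ^ k" kinks x] by (simp add: kinks_def dist_real_def)
  have "\<bar>x - 4 ^ k\<bar> \<le> dist x (4 ^ j)" for j :: nat
  proof -
    have "(4 ^ j :: real) = 4 ^ k \<or> 4 * 4 ^ j \<le> (4 ^ k :: real) \<or> 4 * 4 ^ k \<le> (4 ^ j :: real)"
      using power_increasing[of "Suc j" k "4::real"] power_increasing[of "Suc k" j "4::real"]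
      by (cases j k rule: linorder_cases) auto
    moreover have "0 < (4 ^ j :: real)" "0 < (4 ^ k :: real)"
      by simp_all
    ultimately show ?thesis
      using that unfolding dist_real_def by linarith
  qed
  then show "\<bar>x - 4 ^ k\<bar> \<le> infdist x kinks"
    by (auto simp: infdist_notempty kinks_def intro!: cINF_greatest)
qed

text \<open>The point \<open>5 / 2 * 4 ^ k\<close> is the midpoint of the gap from
  \<open>4 ^ k\<close> to \<open>4 ^ Suc k\<close>, whose half-length is
  \<open>3 / 2 * 4 ^ k\<close>; there the distance has a peak.\<close>

lemma infdist_kinks_mid:
  "infdist x kinks = 3 / 2 * 4 ^ k - \<bar>x - 5 / 2 * 4 ^ k\<bar>" if "\<bar>x - 5 / 2 * 4 ^ k\<bar> \<le> 4 ^ k" for k :: nat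
proof (rule antisym)
  show "infdist x kinks \<le> 3 / 2 * 4 ^ k - \<bar>x - 5 / 2 * 4 ^ k\<bar>"
    using infdist_le[of "4 ^ k" kinks x] infdist_le[of "4 ^ Suc k" kinks x] that
    by (simp add: kinks_def dist_real_def del: power_Suc) (simp add: abs_if split: if_splits)
  have "3 / 2 * 4 ^ k - \<bar>x - 5 / 2 * 4 ^ k\<bar> \<le> dist x (4 ^ j)" for j :: nat
  proof -
    have "4 ^ j \<le> (4 ^ k :: real) \<or> 4 * 4 ^ k \<le> (4 ^ j :: real)"
      using power_increasing[of j k "4::real"] power_increasing[of "Suc k" j "4::real"]
      by (cases "j \<le> k") auto
    then show ?thesis
      using that unfolding dist_real_def by linarith
  qed
  then show "3 / 2 * 4 ^ k - \<bar>x - 5 / 2 * 4 ^ k\<bar> \<le> infdist x kinks"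
    by (auto simp: infdist_notempty kinks_def intro!: cINF_greatest)
qed

text \<open>Take \<open>n\<close> consecutive exponents, starting so high that every gap exceeds
  \<open>L\<close>. The factor \<open>b = 1\<close> yields kinks and \<open>b = 5 / 2\<close> yields
  midpoints.\<close>

lemma separated_scaled_powers:
  fixes L b :: real
  assumes "1 \<le> b" "0 < L"
  obtains T :: "real set" where "finite T" "card T = n"
    "\<And>s. s \<in> T \<Longrightarrow> \<exists>k::nat. s = b * 4 ^ k \<and> L \<le> 4 ^ k / 4"
    "\<And>s t. s \<in> T \<Longrightarrow> t \<in> T \<Longrightarrow> s < t \<Longrightarrow> L \<le> t - s"
proof -
  obtain K :: nat where K: "4 * L < 4 ^ K"
    using real_arch_pow[of 4 "4 * L"] by auto
  define T where "T = (\<lambda>k::nat. b * 4 ^ k) ` {K..<K + n}"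
  have big: "L \<le> 4 ^ k / 4" if "K \<le> k" for k
  proof -
    have "(4::real) ^ K \<le> 4 ^ k"
      using that by (intro power_increasing) auto
    with K show ?thesis by linarith
  qed
  have "inj_on (\<lambda>k::nat. b * 4 ^ k) {K..<K + n}"
    using assms by (auto simp: inj_on_def)
  then have "card T = n"
    by (simp add: T_def card_image)
  moreover have "L \<le> b * 4 ^ j - b * 4 ^ i" if "K \<le> i" "b * 4 ^ i < b * 4 ^ j" for i j :: nat
  proof -
    have "i < j"
      using that assms power_strict_increasing_iff[of "4::real" i j] by simp
    then have "4 * 4 ^ i \<le> (4 ^ j :: real)"
      using power_increasing[of "Suc i" j "4::real"] by simp
    then have "L \<le> 4 ^ j - 4 ^ i"
      using big[OF that(1)] assms(2) by linarith
    moreover from this have "1 * (4 ^ j - 4 ^ i) \<le> b * (4 ^ j - 4 ^ i)"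
      using assms by (intro mult_right_mono) linarith+
    ultimately show ?thesis by (simp add: algebra_simps)
  qed
  ultimately show ?thesis
    using big by (intro that[of T]) (auto simp: T_def)
qed

section \<open>The example\<close>

text \<open>In the variable \<open>ln t\<close>, the function \<open>ln G\<close> has slopes \<open>p\<close> and \<open>q\<close> alternately: it turns
  from \<open>p\<close> to \<open>q\<close> at the points of \<open>kinks\<close> and back from \<open>q\<close> to \<open>p\<close> midway between them.\<close>

locale kinked =
  fixes p q :: real
  assumes p: "0 < p" and pq: "p < q"
begin

text \<open>The distance has slopes 1 and -1, so \<open>H\<close> has slope \<open>q\<close> where
  it grows and slope \<open>p\<close> where it falls.\<close>

definition H :: "real \<Rightarrow> real" where
  "H x = (p + q) / 2 * x + (q - p) / 2 * infdist x kinks"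

definition G :: "real \<Rightarrow> real" where
  "G t = (if 0 < t then exp (H (ln t)) else 0)"

lemma q: "0 < q"
  using p pq by simp

text \<open>The distance to a set is 1-Lipschitz, so the mean slope changes by at most
  \<open>(q - p) / 2\<close> either way.\<close>

lemma H_bounds:
  assumes "x \<le> y"
  shows "p * (y - x) \<le> H y - H x" and "H y - H x \<le> q * (y - x)"
proof -
  have "\<bar>infdist y kinks - infdist x kinks\<bar> \<le> y - x"
    using infdist_triangle_abs[of y kinks x] assms by (simp add: dist_real_def)
  then have "\<bar>(q - p) / 2 * (infdist y kinks - infdist x kinks)\<bar> \<le> (q - p) / 2 * (y - x)"
    using pq by (simp add: abs_mult)
  then show "p * (y - x) \<le> H y - H x" and "H y - H x \<le> q * (y - x)"
    unfolding H_def by (simp_all add: abs_le_iff field_simps)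
qed

lemma G_exp: "G (exp x) = exp (H x)"
  by (simp add: G_def)

lemma G_lower_type:
  assumes "0 < t" "1 \<le> a"
  shows "a powr p * G t \<le> G (a * t)"
proof -
  have "p * ln a + H (ln t) \<le> H (ln t + ln a)"
    using H_bounds(1)[of "ln t" "ln t + ln a"] assms by simp
  then have "exp (p * ln a + H (ln t)) \<le> exp (H (ln t + ln a))"
    by simp
  then show ?thesis
    using assms by (simp add: G_def powr_def exp_add ln_mult add.commute)
qed

lemma G_upper_type:
  assumes "0 < t" "1 \<le> a"
  shows "G (a * t) \<le> a powr q * G t"
proof -
  have "H (ln t + ln a) \<le> q * ln a + H (ln t)"
    using H_bounds(2)[of "ln t" "ln t + ln a"] assms by simp
  then have "exp (H (ln t + ln a)) \<le> exp (q * ln a + H (ln t))"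
    by simp
  then show ?thesis
    using assms by (simp add: G_def powr_def exp_add ln_mult add.commute)
qed

lemma H_less:
  assumes "x < y"
  shows "H x < H y"
proof -
  have "0 < p * (y - x)"
    using assms p by simp
  then show ?thesis
    using H_bounds(1)[of x y] assms by linarith
qed

lemma phi_G: "phi_function G"
proof -
  have cont_pos: "isCont G t" if "0 < t" for t
  proof -
    have "isCont H x" for x
      unfolding H_def[abs_def] by (intro continuous_intros continuous_infdist continuous_ident)
    then have "isCont (\<lambda>t. H (ln t)) t"
      using that by (intro isCont_o2[of t ln H] isCont_ln) auto
    then have "isCont (\<lambda>t. exp (H (ln t))) t"
      by (rule isCont_exp')
    moreover have "eventually (\<lambda>s. exp (H (ln s)) = G s) (nhds t)"
      using eventually_nhds_in_open[of "{0<..}" t] that by (auto elim!: eventually_mono simp: G_def)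
    ultimately show ?thesis
      by (simp add: isCont_cong)
  qed
  \<comment> \<open>Continuity at 0: since \<open>H\<close> has slope at least \<open>p\<close>,
    near 0 \<open>G\<close> lies below \<open>t powr p\<close> times its value
    \<open>exp (H 0)\<close> at 1.\<close>
  have G0: "(G \<longlongrightarrow> 0) (at_right 0)"
  proof (rule tendsto_sandwich[of "\<lambda>_. 0" _ _ "\<lambda>t. t powr p * exp (H 0)"])
    show "eventually (\<lambda>t. G t \<le> t powr p * exp (H 0)) (at_right 0)"
      unfolding eventually_at_right_field
    proof (intro exI[of _ 1] conjI allI impI)
      fix t :: real assume t: "0 < t" "t < 1"
      have "H (ln t) \<le> p * ln t + H 0"
        using H_bounds(1)[of "ln t" 0] t by simp
      then have "exp (H (ln t)) \<le> exp (p * ln t + H 0)"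
        by simp
      then show "G t \<le> t powr p * exp (H 0)"
        using t by (simp add: G_def powr_def exp_add)
    qed simp
    have "((\<lambda>t::real. t powr p) \<longlongrightarrow> 0 powr p) (at_right 0)"
      using p by (intro tendsto_powr' tendsto_ident_at tendsto_const)
        (auto simp: eventually_at_right_field intro: exI[of _ 1])
    then show "((\<lambda>t. t powr p * exp (H 0)) \<longlongrightarrow> 0) (at_right 0)"
      using p by (intro tendsto_mult_left_zero) simp
  qed (auto simp: G_def)
  have "continuous_on {0..} G"
    unfolding continuous_on_eq_continuous_within
  proof
    fix t :: real assume "t \<in> {0..}"
    show "continuous (at t within {0..}) G"
    proof (cases "t = 0")
      case True
      then show ?thesis
        using G0 by (simp add: continuous_within at_within_Ici_at_right G_def[of 0])
    next
      case False
      with \<open>t \<in> {0..}\<close> have "0 < t" by simp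
      then show ?thesis
        by (rule continuous_at_imp_continuous_at_within[OF cont_pos])
    qed
  qed
  moreover have "strict_mono_on {0..} G"
    by (intro strict_mono_onI) (auto simp: G_def intro!: H_less)
  moreover have "filterlim G at_top at_top"
  proof (rule filterlim_at_top_mono)
    show "filterlim (\<lambda>t. t powr p * G 1) at_top at_top"
      using real_powr_at_top[OF p] G_exp[of 0]
      by (intro filterlim_at_top_mult_tendsto_pos[OF tendsto_const]) (auto simp: mult.commute)
    show "eventually (\<lambda>t. t powr p * G 1 \<le> G t) at_top"
      using eventually_ge_at_top[of 1] by eventually_elim (use G_lower_type[of 1] in auto)
  qed
  ultimately show ?thesis
    by (auto simp: phi_function_def G_def)
qed

sublocale pt: power_type G p q
  using phi_G p q G_lower_type G_upper_type by unfold_locales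

section \<open>Corners of \<open>H\<close> with long linear sides\<close>

lemma tildeF_exp: "tildeF G (exp x) = exp (- H (- x))"
  by (simp add: tildeF_def G_exp exp_minus flip: exp_minus inverse_eq_divide)

text \<open>A corner with slope \<open>a\<close> on the left and \<open>b\<close> on the right:
  convex for \<open>p\<close>, \<open>q\<close> and concave for \<open>q\<close>,
  \<open>p\<close>.\<close>

definition kink_at :: "real \<Rightarrow> real \<Rightarrow> real \<Rightarrow> real \<Rightarrow> bool" where
  "kink_at L a b s \<longleftrightarrow> (\<forall>x. 0 \<le> x \<and> x \<le> L \<longrightarrow> H (s - x) = H s - a * x \<and> H (s + x) = H s + b * x)"

lemma kink_atD:
  assumes "kink_at L a b s" "0 \<le> x" "x \<le> L"
  shows "H (s - x) = H s - a * x" "H (s + x) = H s + b * x"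
  using assms by (auto simp: kink_at_def)

text \<open>At a power of 4 the distance has a zero and equals \<open>\<bar>x\<bar>\<close> at
  offset \<open>x\<close>, so the slope rises from \<open>p\<close> to \<open>q\<close>.\<close>

lemma convex_kinks:
  assumes "0 < L"
  shows "\<exists>T. finite T \<and> card T = n \<and> (\<forall>s\<in>T. kink_at L p q s) \<and> (\<forall>s\<in>T. \<forall>t\<in>T. s < t \<longrightarrow> L \<le> t - s)"
proof -
  obtain T where T: "finite T" "card T = n"
    "\<And>s. s \<in> T \<Longrightarrow> \<exists>k::nat. s = 1 * 4 ^ k \<and> L \<le> 4 ^ k / 4"
    "\<And>s t. s \<in> T \<Longrightarrow> t \<in> T \<Longrightarrow> s < t \<Longrightarrow> L \<le> t - s"
    using separated_scaled_powers[of 1 L n] assms by auto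
  have D: "infdist (s + x) kinks = \<bar>x\<bar>" if s: "s \<in> T" and "\<bar>x\<bar> \<le> L" for s x
  proof -
    obtain k :: nat where "s = 4 ^ k" "L \<le> 4 ^ k / 4"
      using T(3)[OF s] by auto
    then show ?thesis
      using infdist_kinks[of "s + x" k] that by simp
  qed
  have up: "H (s + x) = H s + q * x" if "s \<in> T" "0 \<le> x" "x \<le> L" for s x
    using D[OF that(1), of x] D[OF that(1), of 0] that assms by (simp add: H_def field_simps)
  have down: "H (s - x) = H s - p * x" if "s \<in> T" "0 \<le> x" "x \<le> L" for s x
    using D[OF that(1), of "- x"] D[OF that(1), of 0] that assms by (simp add: H_def field_simps)
  show ?thesis
    by (intro exI[of _ T] conjI ballI impI) (simp_all add: T kink_at_def up down)
qed

text \<open>At a midpoint the distance peaks, so the slope drops from \<open>q\<close> to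
  \<open>p\<close>.\<close>

lemma concave_kinks:
  assumes "0 < L"
  shows "\<exists>T. finite T \<and> card T = n \<and> (\<forall>s\<in>T. kink_at L q p s) \<and> (\<forall>s\<in>T. \<forall>t\<in>T. s < t \<longrightarrow> L \<le> t - s)"
proof -
  obtain T where T: "finite T" "card T = n"
    "\<And>s. s \<in> T \<Longrightarrow> \<exists>k::nat. s = 5 / 2 * 4 ^ k \<and> L \<le> 4 ^ k / 4"
    "\<And>s t. s \<in> T \<Longrightarrow> t \<in> T \<Longrightarrow> s < t \<Longrightarrow> L \<le> t - s"
    using separated_scaled_powers[of "5 / 2" L n] assms by auto
  have D: "infdist (s + x) kinks = infdist s kinks - \<bar>x\<bar>" if s: "s \<in> T" and "\<bar>x\<bar> \<le> L" for s x
  proof -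
    obtain k :: nat where "s = 5 / 2 * 4 ^ k" "L \<le> 4 ^ k / 4"
      using T(3)[OF s] by auto
    then show ?thesis
      using infdist_kinks_mid[of "s + x" k] infdist_kinks_mid[of s k] that assms by simp
  qed
  have up: "H (s + x) = H s + p * x" if "s \<in> T" "0 \<le> x" "x \<le> L" for s x
  proof -
    have eq: "infdist (s + x) kinks = infdist s kinks - x"
      using D[OF that(1), of x] that by simp
    show ?thesis unfolding H_def eq by (simp add: field_simps)
  qed
  have down: "H (s - x) = H s - q * x" if "s \<in> T" "0 \<le> x" "x \<le> L" for s x
  proof -
    have eq: "infdist (s - x) kinks = infdist s kinks - x"
      using D[OF that(1), of "- x"] that by simp
    show ?thesis unfolding H_def eq by (simp add: field_simps)
  qed
  show ?thesis
    by (intro exI[of _ T] conjI ballI impI) (simp_all add: T kink_at_def up down)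
qed

text \<open>Turns a distance between corners into the factor 2 that \<open>dil_norm_geI\<close> asks
  of the breakpoints; \<open>H\<close> has slope at least \<open>p\<close>, so it gains
  \<open>ln 2\<close> over length \<open>ln 2 / p\<close>.\<close>

lemma exp_H_separated:
  assumes "ln 2 / p \<le> t - s"
  shows "2 * exp (- H t) \<le> exp (- H s)"
proof -
  have "0 \<le> ln 2 / p"
    using p by simp
  then have "s \<le> t"
    using assms by linarith
  have "ln 2 \<le> p * (t - s)"
    using assms p by (simp add: field_simps)
  also have "\<dots> \<le> H t - H s"
    using \<open>s \<le> t\<close> by (rule H_bounds)
  finally have "exp (ln 2 + - H t) \<le> exp (- H s)"
    by simp
  then show ?thesis
    unfolding exp_add by simp
qed

section \<open>Lower bounds for the dilation norms\<close>

text \<open>For \<open>a = n powr (- 1 / q)\<close> the bound \<open>a powr (- q / p)\<close> of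
  \<open>L1G_norm_dil_contract\<close> is \<open>n powr (1 / p)\<close>, attained here up to the
  constant \<open>4 powr (- 1 / p)\<close>.\<close>

lemma dil_norm_contract_ge:
  fixes n :: nat
  assumes n: "4 \<le> n"
  shows "ereal ((n / 4) powr (1 / p)) \<le> dil_norm (L1G_norm G) (n powr (- 1 / q))"
proof -
  \<comment> \<open>\<open>H\<close> changes by \<open>ln n\<close> over length \<open>B\<close> at
    slope \<open>q\<close>, and by \<open>ln (n / 4)\<close> over length \<open>E\<close> at slope
    \<open>p\<close>. So each of the \<open>n\<close> steps contributes \<open>1 / n\<close> before
    and \<open>4 / n\<close> after dilation and rescaling; the sums are 1 and 4.\<close>
  define B where "B = ln n / q"
  define E where "E = ln (n / 4) / p"
  have n': "0 < ln (real n)" "0 \<le> ln (real n / 4)"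
    using n by auto
  have B: "0 < B" and E: "0 \<le> E" and L2: "0 < ln 2 / p"
    using n' p q by (auto simp: B_def E_def)
  have L: "0 < B + E + ln 2 / p"
    using B E L2 by linarith
  obtain T where T: "finite T" "card T = n"
    and kink: "\<forall>s\<in>T. kink_at (B + E + ln 2 / p) p q s"
    and sep: "\<forall>s\<in>T. \<forall>t\<in>T. s < t \<longrightarrow> B + E + ln 2 / p \<le> t - s"
    using convex_kinks[OF L, of n] by blast
  have Hup: "H (s + B) = H s + ln n" if "s \<in> T" for s
    using kink_atD(2)[OF bspec[OF kink that], of B] B E L2 q by (simp add: B_def)
  have Hdown: "H (s - E) = H s - ln (n / 4)" if "s \<in> T" for s
    using kink_atD(1)[OF bspec[OF kink that], of E] B E L2 p by (simp add: E_def)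
  \<comment> \<open>The step function takes the value \<open>exp s\<close> up to \<open>exp (- (s + B))\<close>: dilation moves the
    latter through a stretch of slope \<open>q\<close>, rescaling moves the former through one of slope \<open>p\<close>.\<close>
  have "ereal (exp E) \<le> dil_norm (L1G_norm G) (exp (- B))"
  proof (rule dil_norm_geI[OF T(1) _ _ _ phi_G, where lam = exp and y = "\<lambda>s. exp (- (s + B))"])
    show "T \<noteq> {}"
      using T n by auto
    show "L1G_norm G (dil (exp (- B)) f) \<le> ereal (exp (- B) powr (- q / p)) * L1G_norm G f" for f
      using B by (intro pt.L1G_norm_dil_contract) auto
    have y: "exp (- (s + B)) / exp (- B) = exp (- s)" for s :: real
      by (simp flip: exp_diff)
    show "2 * tildeF G (exp (- (t + B)) / exp (- B)) \<le> tildeF G (exp (- (s + B)) / exp (- B))"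
      if "s \<in> T" "t \<in> T" "s < t" for s t
    proof -
      have "ln 2 / p \<le> t - s"
        using sep[rule_format, OF that] B E by linarith
      then show ?thesis
        unfolding y tildeF_exp using exp_H_separated by simp
    qed
    have "G (exp s) * tildeF G (exp (- (s + B))) = 1 / n" if "s \<in> T" for s
    proof -
      have "G (exp s) * tildeF G (exp (- (s + B))) = exp (H s - H (s + B))"
        unfolding tildeF_exp by (simp add: G_exp exp_add[symmetric] add.commute[of B])
      also have "\<dots> = exp (- ln n)"
        using Hup[OF that] by simp
      also have "\<dots> = 1 / n"
        using n by (simp add: exp_minus inverse_eq_divide)
      finally show ?thesis .
    qed
    then show "(\<Sum>s\<in>T. G (exp s) * tildeF G (exp (- (s + B)))) \<le> 1"
      using T n by simp
    have "G (exp s / exp E) * tildeF G (exp (- (s + B)) / exp (- B)) = 4 / n" if "s \<in> T" for s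
    proof -
      have "G (exp s / exp E) * tildeF G (exp (- (s + B)) / exp (- B)) = exp (H (s - E) - H s)"
        unfolding y tildeF_exp by (simp add: exp_diff[symmetric] G_exp exp_add[symmetric])
      also have "\<dots> = exp (- ln (n / 4))"
        using Hdown[OF that] by simp
      also have "\<dots> = 4 / n"
        using n by (simp add: exp_minus)
      finally show ?thesis .
    qed
    then show "2 < (\<Sum>s\<in>T. G (exp s / exp E) * tildeF G (exp (- (s + B)) / exp (- B)))"
      using T n by simp
  qed auto
  moreover have "exp E = (n / 4) powr (1 / p)" "exp (- B) = n powr (- 1 / q)"
    using n by (simp_all add: E_def B_def powr_def)
  ultimately show ?thesis by simp
qed

text \<open>For \<open>a = n powr (1 / p)\<close> the bound \<open>a powr (- p / q)\<close> of
  \<open>L1G_norm_dil_expand\<close> is \<open>n powr (- 1 / q)\<close>, again attained up to a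
  constant.\<close>

lemma dil_norm_expand_ge:
  fixes n :: nat
  assumes n: "4 \<le> n"
  shows "ereal (4 powr (- 1 / p) * n powr (- 1 / q)) \<le> dil_norm (L1G_norm G) (n powr (1 / p))"
proof -
  \<comment> \<open>At a concave corner \<open>H\<close> falls by \<open>ln n\<close> over length
    \<open>D\<close> to the left, and rises by \<open>ln n\<close> over \<open>B\<close> and by
    \<open>ln 4\<close> over \<open>E\<close> to the right. The contributions are again
    \<open>1 / n\<close> and \<open>4 / n\<close>.\<close>
  define B where "B = ln n / p"
  define D where "D = ln n / q"
  define E where "E = ln 4 / p"
  have n': "0 < ln (real n)"
    using n by auto
  have B: "0 < B" and D: "0 < D" and E: "0 < E" and L2: "0 < ln 2 / p"
    using n' p q by (auto simp: B_def D_def E_def)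
  have L: "0 < B + D + E + ln 2 / p"
    using B D E L2 by linarith
  obtain T where T: "finite T" "card T = n"
    and kink: "\<forall>s\<in>T. kink_at (B + D + E + ln 2 / p) q p s"
    and sep: "\<forall>s\<in>T. \<forall>t\<in>T. s < t \<longrightarrow> B + D + E + ln 2 / p \<le> t - s"
    using concave_kinks[OF L, of n] by blast
  have HB: "H (s + B) = H s + ln n" if "s \<in> T" for s
    using kink_atD(2)[OF bspec[OF kink that], of B] B D E L2 p by (simp add: B_def)
  have HE: "H (s + E) = H s + ln 4" if "s \<in> T" for s
    using kink_atD(2)[OF bspec[OF kink that], of E] B D E L2 p by (simp add: E_def)
  have HD: "H (s - D) = H s - ln n" if "s \<in> T" for s
    using kink_atD(1)[OF bspec[OF kink that], of D] B D E L2 q by (simp add: D_def)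
  \<comment> \<open>Here dilation acts along slope \<open>p\<close> and rescaling along slope \<open>q\<close>; the extra factor \<open>exp E\<close>
    absorbs the loss of a factor 2 in the lower estimate of the modular.\<close>
  have "ereal (exp (- (D + E))) \<le> dil_norm (L1G_norm G) (exp B)"
  proof (rule dil_norm_geI[OF T(1) _ _ _ phi_G, where lam = "\<lambda>s. exp (s - D)" and y = "\<lambda>s. exp (- s)"])
    show "T \<noteq> {}"
      using T n by auto
    show "L1G_norm G (dil (exp B) f) \<le> ereal (exp B powr (- p / q)) * L1G_norm G f" for f
      using B by (intro pt.L1G_norm_dil_expand) auto
    have y: "exp (- s) / exp B = exp (- (s + B))" for s :: real
      by (simp flip: exp_diff)
    show "2 * tildeF G (exp (- t) / exp B) \<le> tildeF G (exp (- s) / exp B)"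
      if "s \<in> T" "t \<in> T" "s < t" for s t
    proof -
      have "ln 2 / p \<le> (t + B) - (s + B)"
        using sep[rule_format, OF that] B D E by linarith
      then show ?thesis
        unfolding y tildeF_exp using exp_H_separated by simp
    qed
    have "G (exp (s - D)) * tildeF G (exp (- s)) = 1 / n" if "s \<in> T" for s
    proof -
      have "G (exp (s - D)) * tildeF G (exp (- s)) = exp (H (s - D) - H s)"
        unfolding tildeF_exp by (simp add: G_exp exp_add[symmetric])
      also have "\<dots> = exp (- ln n)"
        using HD[OF that] by simp
      also have "\<dots> = 1 / n"
        using n by (simp add: exp_minus inverse_eq_divide)
      finally show ?thesis .
    qed
    then show "(\<Sum>s\<in>T. G (exp (s - D)) * tildeF G (exp (- s))) \<le> 1"
      using T n by simp
    have "G (exp (s - D) / exp (- (D + E))) * tildeF G (exp (- s) / exp B) = 4 / n" if "s \<in> T" for s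
    proof -
      have "exp (s - D) / exp (- (D + E)) = exp (s + E)"
        by (simp flip: exp_diff)
      then have "G (exp (s - D) / exp (- (D + E))) * tildeF G (exp (- s) / exp B) = exp (H (s + E) - H (s + B))"
        unfolding y tildeF_exp by (simp add: G_exp exp_add[symmetric] add.commute[of B])
      also have "\<dots> = exp (ln 4 - ln n)"
        using HE[OF that] HB[OF that] by simp
      also have "\<dots> = 4 / n"
        using n by (simp add: exp_diff)
      finally show ?thesis .
    qed
    then show "2 < (\<Sum>s\<in>T. G (exp (s - D) / exp (- (D + E))) * tildeF G (exp (- s) / exp B))"
      using T n by simp
  qed auto
  moreover have "exp (- (D + E)) = 4 powr (- 1 / p) * n powr (- 1 / q)" "exp B = n powr (1 / p)"
    using n by (simp_all add: D_def E_def B_def powr_def exp_add[symmetric])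
  ultimately show ?thesis by simp
qed

section \<open>The four indices\<close>

text \<open>To the right of a concave corner \<open>s\<close> with sides of length
  \<open>ln n\<close>, \<open>G\<close> grows exactly by \<open>n powr p\<close> from
  \<open>exp s\<close> to \<open>n * exp s\<close>; no larger exponent survives all
  \<open>n\<close>.\<close>

lemma pm_eq: "pm G = ereal p"
proof (rule antisym)
  show "pm G \<le> ereal p"
    unfolding pm_def
  proof (intro Sup_least, clarify)
    fix P c :: real
    assume c: "0 < c" and ge: "\<forall>t a. 0 \<le> t \<and> 1 < a \<longrightarrow> c * a powr P * G t \<le> G (a * t)"
    have "c * real n powr P \<le> 1 * real n powr p" if n: "4 \<le> n" for n :: nat
    proof -
      have L: "0 < ln (real n)" using n by auto
      obtain T where T: "finite T" "card T = 1"
        and "\<forall>s\<in>T. kink_at (ln (real n)) q p s"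
        using concave_kinks[OF L, of 1] by blast
      then obtain s where s: "kink_at (ln (real n)) q p s"
        by (auto simp: card_1_singleton_iff)
      have "c * real n powr P * G (exp s) \<le> G (real n * exp s)"
        using ge n by simp
      also have "real n * exp s = exp (s + ln (real n))"
        using n by (simp add: exp_add)
      also have "G (exp (s + ln (real n))) = real n powr p * G (exp s)"
        unfolding G_exp using kink_atD(2)[OF s, of "ln (real n)"] L n by (simp add: exp_add powr_def)
      finally show ?thesis
        by (simp add: G_exp)
    qed
    from powr_growth_le[OF c this] show "ereal P \<le> ereal p"
      by simp
  qed
qed (rule pt.pm_ge)

text \<open>The same with a convex corner, to the right of which the slope is
  \<open>q\<close>.\<close>

lemma qm_eq: "qm G = ereal q"
proof (rule antisym)
  show "ereal q \<le> qm G"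
    unfolding qm_def
  proof (intro Inf_greatest, clarify)
    fix Q c :: real
    assume le: "\<forall>t a. 0 \<le> t \<and> 1 < a \<longrightarrow> G (a * t) \<le> c * a powr Q * G t"
    have "1 * real n powr q \<le> c * real n powr Q" if n: "4 \<le> n" for n :: nat
    proof -
      have L: "0 < ln (real n)" using n by auto
      obtain T where T: "finite T" "card T = 1"
        and "\<forall>s\<in>T. kink_at (ln (real n)) p q s"
        using convex_kinks[OF L, of 1] by blast
      then obtain s where s: "kink_at (ln (real n)) p q s"
        by (auto simp: card_1_singleton_iff)
      have "real n powr q * G (exp s) = G (exp (s + ln (real n)))"
        unfolding G_exp using kink_atD(2)[OF s, of "ln (real n)"] L n by (simp add: exp_add powr_def)
      also have "exp (s + ln (real n)) = real n * exp s"
        using n by (simp add: exp_add)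
      also have "G (real n * exp s) \<le> c * real n powr Q * G (exp s)"
        using le n by simp
      finally show ?thesis
        by (simp add: G_exp)
    qed
    from powr_growth_le[OF zero_less_one this] show "ereal q \<le> ereal Q"
      by simp
  qed
qed (rule pt.qm_le)

text \<open>Testing an admissible \<open>P\<close> at \<open>a = n powr (- 1 / q)\<close> compares
  the exponents \<open>1 / p\<close> and \<open>1 / (q * P)\<close>.\<close>

lemma lower_boyd_eq: "lower_boyd (L1G_norm G) = ereal (p / q)"
proof (rule antisym)
  show "lower_boyd (L1G_norm G) \<le> ereal (p / q)"
    unfolding lower_boyd_def
  proof (intro Sup_least, clarify)
    fix P c :: real
    assume P: "0 < P"
      and le: "\<forall>a. 0 < a \<and> a < 1 \<longrightarrow> dil_norm (L1G_norm G) a \<le> ereal (c * a powr (- 1 / P))"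
    have "4 powr (- 1 / p) * real n powr (1 / p) \<le> c * real n powr (1 / (q * P))" if n: "4 \<le> n" for n :: nat
    proof -
      have "real n powr (- 1 / q) < real n powr 0"
        using n q by (intro powr_less_mono) auto
      then have "dil_norm (L1G_norm G) (real n powr (- 1 / q)) \<le> ereal (c * (real n powr (- 1 / q)) powr (- 1 / P))"
        using le n by simp
      with dil_norm_contract_ge[OF n]
      have "ereal ((n / 4) powr (1 / p)) \<le> ereal (c * (real n powr (- 1 / q)) powr (- 1 / P))"
        by (rule order_trans)
      then show ?thesis
        by (simp add: powr_powr powr_divide powr_minus_divide)
    qed
    from powr_growth_le[OF _ this] have "1 / p \<le> 1 / (q * P)"
      by simp
    then show "ereal P \<le> ereal (p / q)"
      using p q P by (simp add: field_simps)
  qed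
qed (rule pt.lower_boyd_ge)

text \<open>Testing an admissible \<open>Q\<close> at \<open>a = n powr (1 / p)\<close> compares the
  exponents \<open>- 1 / q\<close> and \<open>- 1 / (p * Q)\<close>.\<close>

lemma upper_boyd_eq: "upper_boyd (L1G_norm G) = ereal (q / p)"
proof (rule antisym)
  show "ereal (q / p) \<le> upper_boyd (L1G_norm G)"
    unfolding upper_boyd_def
  proof (intro Inf_greatest, clarify)
    fix Q c :: real
    assume Q: "0 < Q"
      and le: "\<forall>a. 1 < a \<longrightarrow> dil_norm (L1G_norm G) a \<le> ereal (c * a powr (- 1 / Q))"
    have "4 powr (- 1 / p) * real n powr (- 1 / q) \<le> c * real n powr (- 1 / (p * Q))" if n: "4 \<le> n" for n :: nat
    proof -
      have "real n powr 0 < real n powr (1 / p)"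
        using n p by (intro powr_less_mono) auto
      then have "dil_norm (L1G_norm G) (real n powr (1 / p)) \<le> ereal (c * (real n powr (1 / p)) powr (- 1 / Q))"
        using le n by simp
      with dil_norm_expand_ge[OF n]
      have "ereal (4 powr (- 1 / p) * real n powr (- 1 / q)) \<le> ereal (c * (real n powr (1 / p)) powr (- 1 / Q))"
        by (rule order_trans)
      then show ?thesis
        by (simp add: powr_powr)
    qed
    from powr_growth_le[OF _ this] have "- 1 / q \<le> - 1 / (p * Q)"
      by simp
    then show "ereal (q / p) \<le> ereal Q"
      using p q Q by (simp add: field_simps)
  qed
qed (rule pt.upper_boyd_le)

end

theorem theorem4p1:
  fixes p q :: real
  assumes "0 < p" and "p < q"
  shows "\<exists>G. phi_function G \<and> pm G = ereal p \<and> qm G = ereal q \<and>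
     lower_boyd (L1G_norm G) = ereal (p / q) \<and> upper_boyd (L1G_norm G) = ereal (q / p)"
proof -
  interpret kinked p q
    using assms by unfold_locales
  show ?thesis
    using phi_G pm_eq qm_eq lower_boyd_eq upper_boyd_eq by blast
qed

end
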